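(* Let $\kappa\in\mathbb{Z}$, $p>3$ a prime, and $n\in\mathbb{Z}_{>0}$. Define $T^{\mathrm{all}}_{n,\kappa}(p)=\{(\alpha,\beta)\in\mathbb{F}_p\times\mathbb{F}_p^\times : A_n(\beta/2)=0,\ f_\kappa(\beta,\alpha)=0\}$ and $T^{\mathrm{dist}}_{n,\kappa}(p)=\{(\alpha,\beta)\in T^{\mathrm{all}}_{n,\kappa}(p) : \beta^2(3-\beta)\ne\kappa,\ \beta^2(8-\beta^2)\ne4\kappa\}$. Then $\mathcal{K}^{\mathrm{all}}_{n,\kappa}(p)=\{\sigma(K_{(\alpha,\beta)}) : (\alpha,\beta)\in T^{\mathrm{all}}_{n,\kappa}(p),\ \sigma\in\Sigma\}\sqcup\mathcal{E}_{n,\kappa}(p)$ and $\mathcal{K}^{\mathrm{dist}}_{n,\kappa}(p)=\{\sigma(K_{(\alpha,\beta)}) : (\alpha,\beta)\in T^{\mathrm{dist}}_{n,\kappa}(p),\ \sigma\in\Sigma\}$, where, with $O=(0,0,0)$ and $P=(2,2,2)$, $\mathcal{E}_{n,\kappa}(p)=\{(O,O,O;O,O,O)\}$ if $\kappa\equiv0\pmod p$; $\mathcal{E}_{n,\kappa}(p)=\{\sigma(P,P,P;P,P,P):\sigma\in\Sigma\}$ if $\kappa\equiv4\pmod p$ and $2n+1\not\equiv0\pmod p$; and $\mathcal{E}_{n,\kappa}(p)=\emptyset$ otherwise.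
   Context: $\kappa$ is regarded as an element of $\mathbb{F}_p$. $\mathcal{M}_\kappa(p)=\{(x,y,z)\in\mathbb{F}_p^3 : x^2+y^2+z^2=xyz+\kappa\}$, with Vieta involutions $R_1(x,y,z)=(yz-x,y,z)$, $R_2(x,y,z)=(x,zx-y,z)$, $R_3(x,y,z)=(x,y,xy-z)$; $R_iR_j$ means apply $R_j$ first. For $n\in\mathbb{Z}_{>0}$, $\mathcal{K}^{\mathrm{all}}_{n,\kappa}(p)$ is the set of sextuples $(X_1,X_2,X_3;Y_1,Y_2,Y_3)$ of elements of $\mathcal{M}_\kappa(p)$ with $Y_1=R_1(X_1)=(R_2R_1)^n(X_2)=(R_3R_1)^n(X_3)$, $Y_2=R_2(X_2)=(R_3R_2)^n(X_3)=(R_1R_2)^n(X_1)$, $Y_3=R_3(X_3)=(R_1R_3)^n(X_1)=(R_2R_3)^n(X_2)$; $\mathcal{K}^{\mathrm{dist}}_{n,\kappa}(p)$ is the subset of those whose six triples are pairwise distinct. The polynomials $A_m(x)\in\mathbb{Z}[x]$ are defined by $A_0=1$, $A_1=2x+1$, $A_{m+1}=2xA_m-A_{m-1}$ ($m\ge1$); $f_\kappa(x,y)=y^2-x^2y+2x^2-\kappa$. For $\alpha,\beta\in\mathbb{F}_p$ put $\overline{\alpha}=\beta^2-\alpha$ and $K_{(\alpha,\beta)}=((\alpha,\beta,\beta),(\beta,\alpha,\beta),(\beta,\beta,\alpha);(\overline\alpha,\beta,\beta),(\beta,\overline\alpha,\beta),(\beta,\beta,\overline\alpha))$. $\Sigma$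 is the group of double sign changes $\{\mathrm{id},(x,y,z)\mapsto(x,-y,-z),(x,y,z)\mapsto(-x,y,-z),(x,y,z)\mapsto(-x,-y,z)\}$, acting on sextuples entrywise. *)

theory Defs
  imports "Berlekamp_Zassenhaus.Finite_Field" "HOL-Number_Theory.Cong"
begin

text \<open>
  The prime \<open>p\<close> is \<open>CARD('p)\<close> for a type \<open>'p\<close> of class \<open>prime_card\<close>, and the field with \<open>p\<close>
  elements is \<open>'p mod_ring\<close>. Quantifying over such types \<open>'p\<close> is quantifying over all primes.
  Sextuples \<open>(X1,X2,X3;Y1,Y2,Y3)\<close> are flat tuples.
\<close>

type_synonym 'a triple = "'a \<times> 'a \<times> 'a"

type_synonym 'a sextuple =
  "'a triple \<times> 'a triple \<times> 'a triple \<times> 'a triple \<times> 'a triple \<times> 'a triple"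

definition markoff_surface :: "int \<Rightarrow> 'a::comm_ring_1 triple set" where
  "markoff_surface \<kappa> = {(x, y, z). x\<^sup>2 + y\<^sup>2 + z\<^sup>2 = x * y * z + of_int \<kappa>}"

fun R1 :: "'a::comm_ring_1 triple \<Rightarrow> 'a triple" where
  "R1 (x, y, z) = (y * z - x, y, z)"

fun R2 :: "'a::comm_ring_1 triple \<Rightarrow> 'a triple" where
  "R2 (x, y, z) = (x, z * x - y, z)"

fun R3 :: "'a::comm_ring_1 triple \<Rightarrow> 'a triple" where
  "R3 (x, y, z) = (x, y, x * y - z)"

definition K_all :: "nat \<Rightarrow> int \<Rightarrow> 'a::comm_ring_1 sextuple set" where
  "K_all n \<kappa> = {(X1, X2, X3, Y1, Y2, Y3).
     {X1, X2, X3, Y1, Y2, Y3} \<subseteq> markoff_surface \<kappa> \<and>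
     Y1 = R1 X1 \<and> Y1 = ((R2 \<circ> R1) ^^ n) X2 \<and> Y1 = ((R3 \<circ> R1) ^^ n) X3 \<and>
     Y2 = R2 X2 \<and> Y2 = ((R3 \<circ> R2) ^^ n) X3 \<and> Y2 = ((R1 \<circ> R2) ^^ n) X1 \<and>
     Y3 = R3 X3 \<and> Y3 = ((R1 \<circ> R3) ^^ n) X1 \<and> Y3 = ((R2 \<circ> R3) ^^ n) X2}"

definition K_dist :: "nat \<Rightarrow> int \<Rightarrow> 'a::comm_ring_1 sextuple set" where
  "K_dist n \<kappa> = {(X1, X2, X3, Y1, Y2, Y3).
     (X1, X2, X3, Y1, Y2, Y3) \<in> K_all n \<kappa> \<and> distinct [X1, X2, X3, Y1, Y2, Y3]}"

fun A_poly :: "nat \<Rightarrow> int poly" where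
  "A_poly 0 = 1"
| "A_poly (Suc 0) = [:1, 2:]"
| "A_poly (Suc (Suc m)) = [:0, 2:] * A_poly (Suc m) - A_poly m"

definition f_kappa :: "int \<Rightarrow> 'a::comm_ring_1 \<Rightarrow> 'a \<Rightarrow> 'a" where
  "f_kappa \<kappa> x y = y\<^sup>2 - x\<^sup>2 * y + 2 * x\<^sup>2 - of_int \<kappa>"

definition K_sext :: "'a::comm_ring_1 \<times> 'a \<Rightarrow> 'a sextuple" where
  "K_sext = (\<lambda>(\<alpha>, \<beta>). let \<alpha>' = \<beta>\<^sup>2 - \<alpha> in
     ((\<alpha>, \<beta>, \<beta>), (\<beta>, \<alpha>, \<beta>), (\<beta>, \<beta>, \<alpha>), (\<alpha>', \<beta>, \<beta>), (\<beta>, \<alpha>', \<beta>), (\<beta>, \<beta>, \<alpha>')))"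

definition Sigma_group :: "('a::comm_ring_1 triple \<Rightarrow> 'a triple) set" where
  "Sigma_group =
     {id, \<lambda>(x, y, z). (x, - y, - z), \<lambda>(x, y, z). (- x, y, - z), \<lambda>(x, y, z). (- x, - y, z)}"

fun map_sext :: "('a triple \<Rightarrow> 'a triple) \<Rightarrow> 'a sextuple \<Rightarrow> 'a sextuple" where
  "map_sext \<sigma> (X1, X2, X3, Y1, Y2, Y3) = (\<sigma> X1, \<sigma> X2, \<sigma> X3, \<sigma> Y1, \<sigma> Y2, \<sigma> Y3)"

definition T_all :: "nat \<Rightarrow> int \<Rightarrow> ('a::field \<times> 'a) set" where
  "T_all n \<kappa> = {(\<alpha>, \<beta>). \<beta> \<noteq> 0 \<and>
     poly (map_poly of_int (A_poly n)) (\<beta> / 2) = 0 \<and> f_kappa \<kappa> \<beta> \<alpha> = 0}"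

definition T_dist :: "nat \<Rightarrow> int \<Rightarrow> ('a::field \<times> 'a) set" where
  "T_dist n \<kappa> = {(\<alpha>, \<beta>). (\<alpha>, \<beta>) \<in> T_all n \<kappa> \<and>
     \<beta>\<^sup>2 * (3 - \<beta>) \<noteq> of_int \<kappa> \<and> \<beta>\<^sup>2 * (8 - \<beta>\<^sup>2) \<noteq> 4 * of_int \<kappa>}"

definition E_exc :: "nat \<Rightarrow> int \<Rightarrow> 'p::prime_card mod_ring sextuple set" where
  "E_exc n \<kappa> =
     (let p = int CARD('p); O' = (0, 0, 0); P = (2, 2, 2) in
      if [\<kappa> = 0] (mod p) then {(O', O', O', O', O', O')}
      else if [\<kappa> = 4] (mod p) \<and> \<not> [2 * int n + 1 = 0] (mod p)
        then {map_sext \<sigma> (P, P, P, P, P, P) | \<sigma>. \<sigma> \<in> Sigma_group}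
      else {})"

end

theory Submission
  imports Defs
begin

text \<open>
  The maps \<open>R\<^sub>i R\<^sub>j\<close> fix one coordinate \<open>c\<close> and move the other two along the recurrence
  \<open>s (k + 2) = c s (k + 1) - s k\<close>. The defining equations force a sextuple to be
  \<open>((u,b,c),(a,v,c),(a,b,w);\<dots>)\<close>, and then say that for each fixed coordinate the
  \<open>(2n + 1)\<close>-st power of the transfer matrix exchanges two vectors, for instance \<open>(a,v)\<close> and
  \<open>(b,u)\<close> for \<open>c\<close>. Their sum and difference would be eigenvectors for \<open>1\<close> and \<open>-1\<close>, whereas the
  determinant is \<open>1\<close>; so one of them vanishes and \<open>(a,v) = \<plusminus>(b,u)\<close>. Up to a double sign change
  everything is therefore determined by \<open>\<beta> = a = b = c\<close> and \<open>\<alpha> = u = v = w\<close>, with \<open>(\<beta>,\<alpha>)\<close> fixed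
  by the \<open>(2n + 1)\<close>-st power of the transfer matrix \<open>T\<close> of trace \<open>\<beta>\<close>. Since
  \<open>T\<^sup>2\<^sup>n\<^sup>+\<^sup>1 - 1 = A\<^sub>n(\<beta>/2) T\<^sup>n (T - 1)\<close>, either \<open>A\<^sub>n(\<beta>/2) = 0\<close> or \<open>(\<beta>,\<alpha>)\<close> is fixed by \<open>T\<close> itself,
  which for \<open>\<beta> \<noteq> 0\<close> forces \<open>\<alpha> = \<beta> = 2\<close>; the exceptional point \<open>O\<close> comes from \<open>\<beta> = 0\<close>.
\<close>

section \<open>Solutions of the recurrence with trace \<open>c\<close>\<close>

fun lin_rec :: "'a::comm_ring_1 \<Rightarrow> 'a \<Rightarrow> 'a \<Rightarrow> nat \<Rightarrow> 'a" where
  "lin_rec c x y 0 = x"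
| "lin_rec c x y (Suc 0) = y"
| "lin_rec c x y (Suc (Suc k)) = c * lin_rec c x y (Suc k) - lin_rec c x y k"

lemma lin_rec_add:
  "lin_rec c (x + x') (y + y') k = lin_rec c x y k + lin_rec c x' y' k"
  by (induction c x y k rule: lin_rec.induct) (simp_all add: algebra_simps)

lemma lin_rec_diff:
  "lin_rec c (x - x') (y - y') k = lin_rec c x y k - lin_rec c x' y' k"
  using lin_rec_add[of c "x - x'" x' "y - y'" y' k] by simp

lemma lin_rec_mult:
  "lin_rec c (a * x) (a * y) k = a * lin_rec c x y k"
  by (induction c x y k rule: lin_rec.induct) (simp_all add: algebra_simps)

text \<open>The transfer matrix has determinant 1, so the Casorati determinant of two solutions
  keeps its initial value.\<close>

lemma lin_rec_wronskian:
  "lin_rec c x y k * lin_rec c x' y' (Suc k) - lin_rec c x y (Suc k) * lin_rec c x' y' k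
     = x * y' - y * x'"
proof (induction k)
  case (Suc k)
  then show ?case by (simp add: algebra_simps)
qed simp

lemma lin_rec_shift:
  "lin_rec c (lin_rec c x y m) (lin_rec c x y (Suc m)) k = lin_rec c x y (m + k)"
  by (induction c x y k rule: lin_rec.induct) simp_all

lemma lin_rec_eq_0D:
  assumes "lin_rec c x y k = 0" "lin_rec c x y (Suc k) = 0"
  shows "x = 0 \<and> y = 0"
  using assms by (induction k) auto

lemma lin_rec_trace_0: "lin_rec 0 0 y (Suc (2 * k)) = (- 1) ^ k * y"
  by (induction k) simp_all

section \<open>Vectors exchanged by a power of the transfer matrix\<close>

lemma eq_neg_self_iff:
  fixes x :: "'a::field"
  assumes "(2::'a) \<noteq> 0"
  shows "x = - x \<longleftrightarrow> x = 0"
proof -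
  have "x = - x \<longleftrightarrow> 2 * x = 0" by (simp only: eq_neg_iff_add_eq_0 mult_2)
  then show ?thesis using assms by simp
qed

lemma lin_rec_swap_imp_eq_or_neg:
  fixes c a v b u :: "'a::field"
  assumes two: "(2::'a) \<noteq> 0"
    and st: "lin_rec c a v N = b" "lin_rec c a v (Suc N) = u"
            "lin_rec c b u N = a" "lin_rec c b u (Suc N) = v"
  shows "a = b \<and> v = u \<or> a = - b \<and> v = - u"
proof -
  define p0 where "p0 = a + b"
  define p1 where "p1 = v + u"
  define q0 where "q0 = a - b"
  define q1 where "q1 = v - u"
  note half = eq_neg_self_iff[OF two]
  have pN: "lin_rec c p0 p1 N = p0" "lin_rec c p0 p1 (Suc N) = p1"
    unfolding p0_def p1_def lin_rec_add st by (simp_all add: add.commute)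
  have qN: "lin_rec c q0 q1 N = - q0" "lin_rec c q0 q1 (Suc N) = - q1"
    unfolding q0_def q1_def lin_rec_diff st by simp_all
  \<comment> \<open>After \<open>N\<close> steps one solution returns unchanged and the other
    negated, so their Wronskian is its own negative.\<close>
  have W: "p0 * q1 = p1 * q0"
  proof -
    have "p0 * q1 - p1 * q0 = p0 * (- q1) - p1 * (- q0)"
      using lin_rec_wronskian[of c p0 p1 N q0 q1, symmetric] unfolding pN qN .
    also have "\<dots> = - (p0 * q1 - p1 * q0)" by simp
    finally have "p0 * q1 - p1 * q0 = 0" unfolding half .
    then show ?thesis by simp
  qed
  \<comment> \<open>Proportional initial vectors give proportional solutions. Around
    \<open>N\<close> the left side returns to its start and the right side changes sign, so all
    products of an entry of p and an entry of q vanish.\<close>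
  have eq0: "q0 * lin_rec c p0 p1 k = p0 * lin_rec c q0 q1 k" for k
    using W by (simp flip: lin_rec_mult add: mult.commute)
  have eq1: "q1 * lin_rec c p0 p1 k = p1 * lin_rec c q0 q1 k" for k
    using W by (simp flip: lin_rec_mult add: mult.commute)
  have "p0 * q0 = - (p0 * q0)" using eq0[of N] unfolding pN qN by (simp add: mult.commute)
  then have "p0 * q0 = 0" unfolding half .
  moreover have "p1 * q1 = - (p1 * q1)" using eq1[of "Suc N"] unfolding pN qN by (simp add: mult.commute)
  then have "p1 * q1 = 0" unfolding half .
  moreover have "p0 * q1 = - (p0 * q1)" using eq1[of N] W unfolding pN qN by (simp add: mult.commute)
  then have "p0 * q1 = 0" unfolding half .
  moreover have "p1 * q0 = 0" using \<open>p0 * q1 = 0\<close> W by simp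
  ultimately have "(p0 = 0 \<and> p1 = 0) \<or> (q0 = 0 \<and> q1 = 0)" by auto
  then show ?thesis unfolding p0_def p1_def q0_def q1_def
    by (auto simp: eq_neg_iff_add_eq_0)
qed

section \<open>The values of \<open>A_poly\<close> and fixed vectors\<close>

definition A_half :: "nat \<Rightarrow> 'a::field \<Rightarrow> 'a" where
  "A_half n c = poly (map_poly of_int (A_poly n)) (c / 2)"

text \<open>Halving the argument absorbs the factor 2 in the recurrence of \<open>A_poly\<close>,
  which leaves the recurrence of trace \<open>c\<close>.\<close>

lemma A_half_rec:
  fixes c :: "'a::field"
  assumes "(2::'a) \<noteq> 0"
  shows "A_half 0 c = 1" "A_half (Suc 0) c = 1 + c"
    "A_half (Suc (Suc n)) c = c * A_half (Suc n) c - A_half n c"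
  using assms
  by (simp_all add: A_half_def of_int_poly_hom.hom_minus of_int_poly_hom.hom_mult map_poly_pCons
      del: mult_pCons_left)

text \<open>At trace 2 the values run through 1, 3, 5, and so on. This explains the condition on
  \<open>2 * n + 1\<close> in \<open>E_exc\<close>: for \<kappa> = 4 the pair (2, 2) lies in
  \<open>T_all\<close> exactly if that number vanishes in the field.\<close>

lemma A_half_2:
  assumes "(2::'a::field) \<noteq> 0"
  shows "A_half n (2::'a) = of_nat (2 * n + 1)"
  using assms
proof (induction n rule: A_poly.induct)
  case (3 m)
  then show ?case by (simp add: A_half_rec algebra_simps)
qed (simp_all add: A_half_rec)

text \<open>The factorisation of T^(2n+1) - 1, read off at offset \<open>j\<close>. The offset is
  free because the induction shrinks the window from \<open>j\<close> to
  \<open>j + 2 * n + 1\<close> at both ends, which keeps the middle difference the same.\<close>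

lemma lin_rec_period_factor:
  fixes c :: "'a::field"
  assumes "(2::'a) \<noteq> 0"
  shows "lin_rec c x y (j + 2 * n + 1) - lin_rec c x y j
       = A_half n c * (lin_rec c x y (j + n + 1) - lin_rec c x y (j + n))"
proof (induction n arbitrary: j rule: A_poly.induct)
  case 1
  then show ?case using assms by (simp add: A_half_rec)
next
  case 2
  then show ?case using assms by (simp add: A_half_rec algebra_simps)
next
  case (3 m)
  let ?s = "lin_rec c x y" and ?D = "lin_rec c x y (j + m + 3) - lin_rec c x y (j + m + 2)"
  have "?s (j + 2 * m + 5) = c * ?s (j + 2 * m + 4) - ?s (j + 2 * m + 3)"
    and "?s (j + 2) = c * ?s (j + 1) - ?s j"
    by (simp_all add: numeral_eq_Suc)
  then have "?s (j + 2 * m + 5) - ?s j =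
      c * (?s (j + 2 * m + 4) - ?s (j + 1)) - (?s (j + 2 * m + 3) - ?s (j + 2))"
    by (simp add: algebra_simps)
  also have "?s (j + 2 * m + 4) - ?s (j + 1) = A_half (Suc m) c * ?D"
    using 3(1)[of "j + 1"] by (simp add: numeral_eq_Suc)
  also have "?s (j + 2 * m + 3) - ?s (j + 2) = A_half m c * ?D"
    using 3(2)[of "j + 2"] by (simp add: numeral_eq_Suc)
  also have "c * (A_half (Suc m) c * ?D) - A_half m c * ?D = A_half (Suc (Suc m)) c * ?D"
    using assms by (simp add: A_half_rec left_diff_distrib mult.assoc)
  finally show ?case by (simp add: numeral_eq_Suc)
qed

text \<open>The second alternative says that \<open>(x, y)\<close> is fixed by the transfer matrix
  itself.\<close>

lemma lin_rec_period_iff: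
  fixes c :: "'a::field"
  assumes two: "(2::'a) \<noteq> 0"
  shows "lin_rec c x y (2 * n + 1) = x \<and> lin_rec c x y (Suc (2 * n + 1)) = y \<longleftrightarrow>
         A_half n c = 0 \<or> x = y \<and> c * y = 2 * y"
    (is "?L \<longleftrightarrow> ?R")
proof -
  \<comment> \<open>Consecutive differences form another solution, which vanishes at
    \<open>n\<close> and \<open>Suc n\<close> only if it vanishes from the start.\<close>
  have e: "lin_rec c (y - x) (c * y - x - y) k = lin_rec c x y (Suc k) - lin_rec c x y k" for k
    using lin_rec_shift[of c x y 1 k] lin_rec_diff[of c y x "c * y - x" y k] by simp
  have "?L \<longleftrightarrow> A_half n c * lin_rec c (y - x) (c * y - x - y) n = 0 \<and>
               A_half n c * lin_rec c (y - x) (c * y - x - y) (Suc n) = 0"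
    using lin_rec_period_factor[OF two, of c x y 0 n] lin_rec_period_factor[OF two, of c x y 1 n]
    unfolding e by (auto simp: algebra_simps)
  also have "\<dots> \<longleftrightarrow> A_half n c = 0 \<or> (y - x = 0 \<and> c * y - x - y = 0)"
  proof -
    have "lin_rec c 0 0 k = 0" for k
      using lin_rec_mult[of c 0 0 0 k] by simp
    then show ?thesis
      using lin_rec_eq_0D[of c "y - x" "c * y - x - y" n] by auto
  qed
  also have "\<dots> \<longleftrightarrow> ?R" by (auto simp: algebra_simps)
  finally show ?thesis .
qed

text \<open>Each composition makes two steps of the recurrence whose trace is the fixed coordinate;
  the coordinate moved first is the first seed.\<close>

lemma funpow_R:
  "((R2 \<circ> R1) ^^ n) (x, y, z) = (lin_rec z x y (2 * n), lin_rec z x y (2 * n + 1), z)"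
  "((R3 \<circ> R1) ^^ n) (x, y, z) = (lin_rec y x z (2 * n), y, lin_rec y x z (2 * n + 1))"
  "((R3 \<circ> R2) ^^ n) (x, y, z) = (x, lin_rec x y z (2 * n), lin_rec x y z (2 * n + 1))"
  "((R1 \<circ> R2) ^^ n) (x, y, z) = (lin_rec z y x (2 * n + 1), lin_rec z y x (2 * n), z)"
  "((R1 \<circ> R3) ^^ n) (x, y, z) = (lin_rec y z x (2 * n + 1), y, lin_rec y z x (2 * n))"
  "((R2 \<circ> R3) ^^ n) (x, y, z) = (x, lin_rec x z y (2 * n + 1), lin_rec x z y (2 * n))"
  by (induction n) (simp_all add: algebra_simps)

section \<open>Sextuples on the surface in coordinates\<close>

lemma markoff_surface_iff:
  "(x, y, z) \<in> markoff_surface \<kappa> \<longleftrightarrow> x\<^sup>2 + y\<^sup>2 + z\<^sup>2 = x * y * z + of_int \<kappa>"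
  by (simp add: markoff_surface_def)

text \<open>Each involution exchanges the two roots of the surface equation in one
  coordinate.\<close>

lemma R_in_markoff_surface:
  assumes "X \<in> markoff_surface \<kappa>"
  shows "R1 X \<in> markoff_surface \<kappa>" "R2 X \<in> markoff_surface \<kappa>" "R3 X \<in> markoff_surface \<kappa>"
proof -
  obtain x y z where X: "X = (x, y, z)" by (cases X)
  have "x\<^sup>2 + y\<^sup>2 + z\<^sup>2 = x * y * z + of_int \<kappa>"
    using assms by (simp add: X markoff_surface_iff)
  moreover have "(y * z - x)\<^sup>2 + y\<^sup>2 + z\<^sup>2 - (y * z - x) * y * z = x\<^sup>2 + y\<^sup>2 + z\<^sup>2 - x * y * z"
    "x\<^sup>2 + (z * x - y)\<^sup>2 + z\<^sup>2 - x * (z * x - y) * z = x\<^sup>2 + y\<^sup>2 + z\<^sup>2 - x * y * z"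
    "x\<^sup>2 + y\<^sup>2 + (x * y - z)\<^sup>2 - x * y * (x * y - z) = x\<^sup>2 + y\<^sup>2 + z\<^sup>2 - x * y * z"
    by (simp_all add: power2_eq_square algebra_simps)
  ultimately show "R1 X \<in> markoff_surface \<kappa>" "R2 X \<in> markoff_surface \<kappa>" "R3 X \<in> markoff_surface \<kappa>"
    unfolding X R1.simps R2.simps R3.simps markoff_surface_iff by (simp_all add: diff_eq_eq)
qed

text \<open>The composition of \<open>R2\<close> and \<open>R1\<close> keeps the third coordinate,
  so \<open>X1\<close> and \<open>X2\<close> share it as \<open>c\<close>; \<open>a\<close> and
  \<open>b\<close> arise likewise, and \<open>u\<close>, \<open>v\<close>, \<open>w\<close> are the
  unshared entries.\<close>

definition sext :: "'a::comm_ring_1 \<Rightarrow> 'a \<Rightarrow> 'a \<Rightarrow> 'a \<Rightarrow> 'a \<Rightarrow> 'a \<Rightarrow> 'a sextuple" where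
  "sext a b c u v w =
     ((u, b, c), (a, v, c), (a, b, w), R1 (u, b, c), R2 (a, v, c), R3 (a, b, w))"

lemma K_sext_eq: "K_sext (\<alpha>, \<beta>) = sext \<beta> \<beta> \<beta> \<alpha> \<alpha> \<alpha>"
  by (simp add: K_sext_def sext_def power2_eq_square Let_def)

text \<open>Moving the involution across each equation costs one more recurrence step, which turns
  2n steps into 2n + 1. The twelve conditions are three exchanges of two vectors, with traces
  \<open>c\<close>, \<open>a\<close> and \<open>b\<close>.\<close>

lemma sext_in_K_all_iff:
  "sext a b c u v w \<in> K_all n \<kappa> \<longleftrightarrow>
     {(u, b, c), (a, v, c), (a, b, w)} \<subseteq> markoff_surface \<kappa> \<and>
     lin_rec c a v (2 * n + 1) = b \<and> lin_rec c a v (Suc (2 * n + 1)) = u \<and>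
     lin_rec c b u (2 * n + 1) = a \<and> lin_rec c b u (Suc (2 * n + 1)) = v \<and>
     lin_rec a b w (2 * n + 1) = c \<and> lin_rec a b w (Suc (2 * n + 1)) = v \<and>
     lin_rec a c v (2 * n + 1) = b \<and> lin_rec a c v (Suc (2 * n + 1)) = w \<and>
     lin_rec b c u (2 * n + 1) = a \<and> lin_rec b c u (Suc (2 * n + 1)) = w \<and>
     lin_rec b a w (2 * n + 1) = c \<and> lin_rec b a w (Suc (2 * n + 1)) = u"
proof -
  have R: "R1 (u, b, c) = (p, q, c) \<longleftrightarrow> q = b \<and> c * q - p = u"
    "R1 (u, b, c) = (p, b, q) \<longleftrightarrow> q = c \<and> b * q - p = u"
    "R2 (a, v, c) = (a, p, q) \<longleftrightarrow> q = c \<and> a * q - p = v"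
    "R2 (a, v, c) = (q, p, c) \<longleftrightarrow> q = a \<and> c * q - p = v"
    "R3 (a, b, w) = (q, b, p) \<longleftrightarrow> q = a \<and> b * q - p = w"
    "R3 (a, b, w) = (a, q, p) \<longleftrightarrow> q = b \<and> a * q - p = w" for p q
    by (auto simp: algebra_simps)
  have s: "lin_rec c x y (Suc (2 * n + 1)) = c * lin_rec c x y (2 * n + 1) - lin_rec c x y (2 * n)"
    for c x y :: 'a by simp
  have M: "{X1, X2, X3, R1 X1, R2 X2, R3 X3} \<subseteq> markoff_surface \<kappa> \<longleftrightarrow>
      {X1, X2, X3} \<subseteq> markoff_surface \<kappa>" for X1 X2 X3 :: "'a triple"
    using R_in_markoff_surface by blast
  show ?thesis
    unfolding sext_def K_all_def mem_Collect_eq split M s funpow_R R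
    by blast
qed

lemma K_all_imp_sext:
  assumes "S \<in> K_all n \<kappa>"
  obtains a b c u v w where "S = sext a b c u v w"
  using assms by (auto simp: K_all_def sext_def funpow_R)

section \<open>Double sign changes\<close>

lemma Sigma_cases:
  assumes "\<sigma> \<in> Sigma_group"
  obtains d e f :: "'a::comm_ring_1" where
    "\<And>x y z. \<sigma> (x, y, z) = (d * x, e * y, f * z)"
    "d * e = f" "e * f = d" "f * d = e" "d * d = 1" "e * e = 1" "f * f = 1"
proof -
  from assms consider "\<sigma> = id" | "\<sigma> = (\<lambda>(x, y, z). (x, - y, - z))"
    | "\<sigma> = (\<lambda>(x, y, z). (- x, y, - z))" | "\<sigma> = (\<lambda>(x, y, z). (- x, - y, z))"
    unfolding Sigma_group_def by blast
  then show ?thesis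
  proof cases
    case 1 show ?thesis by (rule that[of 1 1 1]) (simp_all add: 1)
  next
    case 2 show ?thesis by (rule that[of 1 "- 1" "- 1"]) (simp_all add: 2)
  next
    case 3 show ?thesis by (rule that[of "- 1" 1 "- 1"]) (simp_all add: 3)
  next
    case 4 show ?thesis by (rule that[of "- 1" "- 1" 1]) (simp_all add: 4)
  qed
qed

lemma Sigma_involutive:
  assumes "\<sigma> \<in> Sigma_group"
  shows "map_sext \<sigma> (map_sext \<sigma> S) = S"
  using assms by (cases S) (auto simp: Sigma_group_def)

text \<open>The product of any two of the signs is the third, so a product of two coordinates
  transforms like the remaining coordinate. Hence \<sigma> commutes with the involutions and
  preserves the surface.\<close>

lemma K_all_Sigma:
  assumes "\<sigma> \<in> Sigma_group" "S \<in> K_all n \<kappa>"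
  shows "map_sext \<sigma> S \<in> K_all n \<kappa>"
proof -
  from assms(1) obtain d e f :: 'a where
    s: "\<And>x y z. \<sigma> (x, y, z) = (d * x, e * y, f * z)"
    and m: "d * e = f" "e * f = d" "f * d = e" "d * d = 1" "e * e = 1" "f * f = 1"
    by (rule Sigma_cases) blast
  have V: "d * (x * y) = e * x * (f * y)" "e * (x * y) = f * x * (d * y)"
    "f * (x * y) = d * x * (e * y)" for x y
  proof -
    have I: "g * x * (h * y) = (g * h) * (x * y)" for g h :: 'a by (simp only: mult_ac)
    show "d * (x * y) = e * x * (f * y)" "e * (x * y) = f * x * (d * y)"
      "f * (x * y) = d * x * (e * y)" by (simp_all only: I m)
  qed
  have R: "R1 (\<sigma> X) = \<sigma> (R1 X)" "R2 (\<sigma> X) = \<sigma> (R2 X)" "R3 (\<sigma> X) = \<sigma> (R3 X)" for X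
    by (cases X; simp add: s right_diff_distrib V)+
  have F: "((g \<circ> h) ^^ n) (\<sigma> X) = \<sigma> (((g \<circ> h) ^^ n) X)"
    if "\<And>X. g (\<sigma> X) = \<sigma> (g X)" "\<And>X. h (\<sigma> X) = \<sigma> (h X)" for g h X
    by (induction n) (simp_all add: that)
  have M: "\<sigma> X \<in> markoff_surface \<kappa>" if "X \<in> markoff_surface \<kappa>" for X
  proof -
    obtain x y z where X: "X = (x, y, z)" by (cases X)
    have "(d * x)\<^sup>2 = x\<^sup>2" "(e * y)\<^sup>2 = y\<^sup>2" "(f * z)\<^sup>2 = z\<^sup>2"
      unfolding power_mult_distrib unfolding power2_eq_square m by simp_all
    moreover have "d * x * (e * y) * (f * z) = (d * e) * f * (x * y * z)"
      by (simp only: mult_ac)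
    then have "d * x * (e * y) * (f * z) = x * y * z"
      by (simp only: m mult_1)
    ultimately show ?thesis using that unfolding X s markoff_surface_iff by simp
  qed
  obtain X1 X2 X3 Y1 Y2 Y3 where S: "S = (X1, X2, X3, Y1, Y2, Y3)" by (cases S)
  show ?thesis using assms(2) M
    unfolding S map_sext.simps K_all_def mem_Collect_eq split
    by (simp add: F[of R2 R1, OF R(2,1)] F[of R3 R1, OF R(3,1)] F[of R3 R2, OF R(3,2)]
      F[of R1 R2, OF R(1,2)] F[of R1 R3, OF R(1,3)] F[of R2 R3, OF R(2,3)] R) metis
qed

section \<open>Classification of the sextuples\<close>

lemma K_sext_in_K_all:
  fixes \<alpha> \<beta> :: "'a::field"
  assumes "(2::'a) \<noteq> 0" "(\<alpha>, \<beta>) \<in> T_all n \<kappa>"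
  shows "K_sext (\<alpha>, \<beta>) \<in> K_all n \<kappa>"
  \<comment> \<open>With all traces equal to \<beta>, every exchange says that (\<beta>, \<alpha>)
    is fixed, and every surface equation is the one for \<open>f_kappa\<close>.\<close>
  using assms lin_rec_period_iff[OF assms(1), of \<beta> \<beta> \<alpha> n]
  unfolding K_sext_eq sext_in_K_all_iff
  by (auto simp: T_all_def A_half_def f_kappa_def markoff_surface_iff power2_eq_square algebra_simps)

text \<open>The three alternatives correspond to the point O, the point P and the family over
  \<open>T_all\<close>.\<close>

lemma K_all_cases:
  fixes S :: "'a::field sextuple"
  assumes two: "(2::'a) \<noteq> 0" and S: "S \<in> K_all n \<kappa>"
  obtains (zero) "of_int \<kappa> = (0::'a)" "S = sext 0 0 0 0 0 0"
  | (exc) \<sigma> where "of_int \<kappa> = (4::'a)" "of_nat (2 * n + 1) \<noteq> (0::'a)" "\<sigma> \<in> Sigma_group"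
      "S = map_sext \<sigma> (K_sext (2, 2))"
  | (gen) \<alpha> \<beta> \<sigma> where "(\<alpha>, \<beta>) \<in> T_all n \<kappa>" "\<sigma> \<in> Sigma_group" "S = map_sext \<sigma> (K_sext (\<alpha>, \<beta>))"
proof -
  obtain a b c u v w where S': "S = sext a b c u v w"
    using S by (rule K_all_imp_sext)
  note I = S[unfolded S' sext_in_K_all_iff]
  have ab: "a = b \<and> v = u \<or> a = - b \<and> v = - u"
    by (rule lin_rec_swap_imp_eq_or_neg[OF two, of c _ _ "2 * n + 1"]) (use I in blast)+
  have bc: "b = c \<and> w = v \<or> b = - c \<and> w = - v"
    by (rule lin_rec_swap_imp_eq_or_neg[OF two, of a _ _ "2 * n + 1"]) (use I in blast)+
  have ca: "c = a \<and> u = w \<or> c = - a \<and> u = - w"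
    by (rule lin_rec_swap_imp_eq_or_neg[OF two, of b _ _ "2 * n + 1"]) (use I in blast)+
  note half = eq_neg_self_iff[OF two]
  show ?thesis
  proof (cases "a = 0")
    case True
    then have 0: "a = 0" "b = 0" "c = 0" using ab bc by auto
    \<comment> \<open>With trace 0 a double step is a sign change, so \<open>b\<close> is
      \<open>v\<close> up to sign.\<close>
    then have "v = 0" using I lin_rec_trace_0[of v n] by simp
    then have "u = 0" "w = 0" using ab bc by auto
    show ?thesis
      by (rule zero) (use I 0 \<open>u = 0\<close> \<open>v = 0\<close> \<open>w = 0\<close> S' in \<open>simp_all add: markoff_surface_iff\<close>)
  next
    case False
    have "\<exists>\<sigma> \<in> Sigma_group. \<exists>\<alpha> \<beta>. \<beta> \<noteq> 0 \<and> S = map_sext \<sigma> (K_sext (\<alpha>, \<beta>))"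
    proof -
      \<comment> \<open>An odd number of minus signs around the cycle would give
        \<open>a = - a\<close>. The four remaining patterns match the four elements of
        \<open>Sigma_group\<close>.\<close>
      have "a \<noteq> - a" using half False by blast
      then have "(b = a \<and> c = a \<and> v = u \<and> w = u) \<or> (b = - a \<and> c = - a \<and> v = - u \<and> w = - u)
          \<or> (b = - a \<and> c = a \<and> v = - u \<and> w = u) \<or> (b = a \<and> c = - a \<and> v = u \<and> w = - u)"
        using ab bc ca by auto
      then consider "b = a" "c = a" "v = u" "w = u" | "b = - a" "c = - a" "v = - u" "w = - u"
        | "b = - a" "c = a" "v = - u" "w = u" | "b = a" "c = - a" "v = u" "w = - u"
        by blast
      then show ?thesis
      proof cases
        case 1
        then show ?thesis using False S'
          by (intro bexI[of _ id] exI[of _ u] exI[of _ a])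
             (auto simp: K_sext_eq Sigma_group_def sext_def)
      next
        case 2
        then show ?thesis using False S'
          by (intro bexI[of _ "\<lambda>(x, y, z). (x, - y, - z)"] exI[of _ u] exI[of _ a])
             (auto simp: K_sext_eq Sigma_group_def sext_def)
      next
        \<comment> \<open>Here and in the next case \<sigma> negates the first coordinate, so the
          parameters are \<open>- u\<close> and \<open>- a\<close>.\<close>
        case 3
        then show ?thesis using False S'
          by (intro bexI[of _ "\<lambda>(x, y, z). (- x, y, - z)"] exI[of _ "- u"] exI[of _ "- a"])
             (auto simp: K_sext_eq Sigma_group_def sext_def)
      next
        case 4
        then show ?thesis using False S'
          by (intro bexI[of _ "\<lambda>(x, y, z). (- x, - y, z)"] exI[of _ "- u"] exI[of _ "- a"])
             (auto simp: K_sext_eq Sigma_group_def sext_def)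
      qed
    qed
    then obtain \<sigma> \<alpha> \<beta> where \<sigma>: "\<sigma> \<in> Sigma_group" and \<beta>: "\<beta> \<noteq> 0"
      and Seq: "S = map_sext \<sigma> (K_sext (\<alpha>, \<beta>))" by blast
    have "K_sext (\<alpha>, \<beta>) \<in> K_all n \<kappa>"
      using K_all_Sigma[OF \<sigma> S] Sigma_involutive[OF \<sigma>] Seq by metis
    then have M: "(\<alpha>, \<beta>, \<beta>) \<in> markoff_surface \<kappa>"
      and P: "lin_rec \<beta> \<beta> \<alpha> (2 * n + 1) = \<beta> \<and> lin_rec \<beta> \<beta> \<alpha> (Suc (2 * n + 1)) = \<alpha>"
      unfolding K_sext_eq sext_in_K_all_iff by auto
    have f: "f_kappa \<kappa> \<beta> \<alpha> = 0"
      using M by (simp add: f_kappa_def markoff_surface_iff power2_eq_square algebra_simps)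
    show ?thesis
    proof (cases "A_half n \<beta> = 0")
      case True
      then show ?thesis using gen[OF _ \<sigma> Seq] \<beta> f by (simp add: T_all_def A_half_def)
    next
      case False
      \<comment> \<open>Now (\<beta>, \<alpha>) is fixed by the transfer matrix itself; cancelling
        \<alpha> = \<beta>, which is nonzero, leaves 2.\<close>
      then have "\<beta> = \<alpha>" "\<beta> * \<alpha> = 2 * \<alpha>" using P lin_rec_period_iff[OF two] by blast+
      then have e: "\<beta> = 2" "\<alpha> = 2" using \<beta> by auto
      have "of_int \<kappa> = (4::'a)"
        using f unfolding e f_kappa_def by (simp add: algebra_simps)
      then show ?thesis using exc[OF _ _ \<sigma>] Seq False A_half_2[OF assms(1), of n] e by simp
    qed
  qed
qed

section \<open>Coincidences among the six triples\<close>

lemma distinct_K_sext_iff: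
  fixes \<alpha> \<beta> :: "'a::field"
  assumes "(2::'a) \<noteq> 0" "f_kappa \<kappa> \<beta> \<alpha> = 0"
  shows "(case K_sext (\<alpha>, \<beta>) of (X1, X2, X3, Y1, Y2, Y3) \<Rightarrow> distinct [X1, X2, X3, Y1, Y2, Y3]) \<longleftrightarrow>
    \<beta>\<^sup>2 * (3 - \<beta>) \<noteq> of_int \<kappa> \<and> \<beta>\<^sup>2 * (8 - \<beta>\<^sup>2) \<noteq> 4 * of_int \<kappa>"
proof -
  have \<kappa>: "of_int \<kappa> = \<alpha>\<^sup>2 - \<beta>\<^sup>2 * \<alpha> + 2 * \<beta>\<^sup>2"
    using assms(2) by (simp add: f_kappa_def algebra_simps)
  \<comment> \<open>The left side is \<open>f_kappa \<kappa> \<beta> \<beta>\<close>, factored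
    through the roots \<alpha> and \<open>\<beta>\<^sup>2 - \<alpha>\<close> of
    \<open>f_kappa \<kappa> \<beta>\<close>.\<close>
  have "\<beta>\<^sup>2 * (3 - \<beta>) - of_int \<kappa> = (\<beta> - \<alpha>) * (\<alpha> - (\<beta>\<^sup>2 - \<beta>))"
    unfolding \<kappa> by (simp add: power2_eq_square algebra_simps)
  then have "\<beta>\<^sup>2 * (3 - \<beta>) = of_int \<kappa> \<longleftrightarrow> \<beta> - \<alpha> = 0 \<or> \<alpha> - (\<beta>\<^sup>2 - \<beta>) = 0"
    by (metis eq_iff_diff_eq_0 mult_eq_0_iff)
  then have 1: "\<beta>\<^sup>2 * (3 - \<beta>) = of_int \<kappa> \<longleftrightarrow> \<alpha> = \<beta> \<or> \<beta>\<^sup>2 - \<alpha> = \<beta>"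
    by (auto simp: algebra_simps)
  \<comment> \<open>The discriminant of the same quadratic, hence the squared difference of its
    roots.\<close>
  have "4 * of_int \<kappa> - \<beta>\<^sup>2 * (8 - \<beta>\<^sup>2) = (2 * \<alpha> - \<beta>\<^sup>2)\<^sup>2"
    unfolding \<kappa> by (simp add: power2_eq_square algebra_simps)
  then have "\<beta>\<^sup>2 * (8 - \<beta>\<^sup>2) = 4 * of_int \<kappa> \<longleftrightarrow> 2 * \<alpha> - \<beta>\<^sup>2 = 0"
    by (metis eq_iff_diff_eq_0 power_eq_0_iff zero_power2)
  then have 2: "\<beta>\<^sup>2 * (8 - \<beta>\<^sup>2) = 4 * of_int \<kappa> \<longleftrightarrow> \<alpha> = \<beta>\<^sup>2 - \<alpha>"
    by (simp add: algebra_simps mult_2)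
  show ?thesis unfolding 1 2 by (auto simp: K_sext_def Let_def)
qed

lemma Sigma_inj:
  assumes "\<sigma> \<in> Sigma_group"
  shows "inj \<sigma>"
  using assms by (auto simp: Sigma_group_def inj_def)

lemma distinct_map_sext:
  assumes "\<sigma> \<in> Sigma_group"
  shows "(case map_sext \<sigma> S of (X1, X2, X3, Y1, Y2, Y3) \<Rightarrow> distinct [X1, X2, X3, Y1, Y2, Y3]) =
    (case S of (X1, X2, X3, Y1, Y2, Y3) \<Rightarrow> distinct [X1, X2, X3, Y1, Y2, Y3])"
  by (cases S) (simp add: inj_eq[OF Sigma_inj[OF assms]])

section \<open>The decomposition over the prime field and its disjointness\<close>

theorem theorem3p6:
  fixes \<kappa> :: int and n :: nat
  assumes "CARD('p::prime_card) > 3" and "n > 0"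
  shows "(K_all n \<kappa> :: 'p mod_ring sextuple set) =
           {map_sext \<sigma> (K_sext (\<alpha>, \<beta>)) | \<alpha> \<beta> \<sigma>. (\<alpha>, \<beta>) \<in> T_all n \<kappa> \<and> \<sigma> \<in> Sigma_group} \<union> E_exc n \<kappa> \<and>
         {map_sext \<sigma> (K_sext (\<alpha>, \<beta>)) | \<alpha> \<beta> \<sigma>. (\<alpha>, \<beta>) \<in> T_all n \<kappa> \<and> \<sigma> \<in> Sigma_group} \<inter>
           (E_exc n \<kappa> :: 'p mod_ring sextuple set) = {} \<and>
         (K_dist n \<kappa> :: 'p mod_ring sextuple set) =
           {map_sext \<sigma> (K_sext (\<alpha>, \<beta>)) | \<alpha> \<beta> \<sigma>. (\<alpha>, \<beta>) \<in> T_dist n \<kappa> \<and> \<sigma> \<in> Sigma_group}"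
proof -
  have cong: "[a = b] (mod int CARD('p)) \<longleftrightarrow> (of_int a :: 'p mod_ring) = of_int b" for a b
    by (simp add: of_int_eq_iff_cong_CHAR)
  have two: "(2 :: 'p mod_ring) \<noteq> 0"
  proof
    assume "(2 :: 'p mod_ring) = 0"
    then have "(of_nat 2 :: 'p mod_ring) = 0" by simp
    then have "CARD('p) dvd 2" by (simp only: of_nat_eq_0_iff_char_dvd semiring_char_mod_ring)
    then show False using assms(1) by (auto dest: dvd_imp_le)
  qed
  \<comment> \<open>This keeps \<kappa> = 4 out of the first branch of \<open>E_exc\<close>.\<close>
  then have four: "(4 :: 'p mod_ring) \<noteq> 0"
    using mult_eq_0_iff[of 2 "2 :: 'p mod_ring"] by simp
  let ?T = "{map_sext \<sigma> (K_sext (\<alpha>, \<beta>)) | \<alpha> \<beta> \<sigma>.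
    (\<alpha>, \<beta>) \<in> T_all n \<kappa> \<and> \<sigma> \<in> Sigma_group} :: 'p mod_ring sextuple set"
  let ?N = "of_nat (2 * n + 1) :: 'p mod_ring"
  have P: "((2, 2, 2), (2, 2, 2), (2, 2, 2), (2, 2, 2), (2, 2, 2), (2, 2, 2)) =
      K_sext (2, 2 :: 'p mod_ring)"
    by (simp add: K_sext_def)
  have O: "((0, 0, 0), (0, 0, 0), (0, 0, 0), (0, 0, 0), (0, 0, 0), (0, 0, 0)) =
      sext 0 0 0 0 0 (0 :: 'p mod_ring)"
    by (simp add: sext_def)
  have N: "[2 * int n + 1 = 0] (mod int CARD('p)) \<longleftrightarrow> ?N = 0"
    unfolding cong by (simp add: add.commute)
  have E: "(E_exc n \<kappa> :: 'p mod_ring sextuple set) =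
     (if of_int \<kappa> = (0 :: 'p mod_ring) then {sext 0 0 0 0 0 0}
      else if of_int \<kappa> = (4 :: 'p mod_ring) \<and> ?N \<noteq> 0
        then {map_sext \<sigma> (K_sext (2, 2)) | \<sigma>. \<sigma> \<in> Sigma_group} else {})"
    unfolding E_exc_def Let_def N unfolding cong P O by simp
  have zero: "sext 0 0 0 0 0 0 \<in> (K_all n \<kappa> :: 'p mod_ring sextuple set)"
    if "of_int \<kappa> = (0 :: 'p mod_ring)"
  proof -
    have "lin_rec 0 0 0 k = (0 :: 'p mod_ring)" for k
      using lin_rec_mult[of "0 :: 'p mod_ring" 0 0 0 k] by simp
    then show ?thesis using that unfolding sext_in_K_all_iff by (simp add: markoff_surface_iff)
  qed
  \<comment> \<open>The vector (2, 2) is fixed by the transfer matrix of trace 2.\<close>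
  have exc: "K_sext (2, 2) \<in> (K_all n \<kappa> :: 'p mod_ring sextuple set)"
    if "of_int \<kappa> = (4 :: 'p mod_ring)"
    using that lin_rec_period_iff[OF two, of 2 2 2 n]
    unfolding K_sext_eq sext_in_K_all_iff
    by (simp add: markoff_surface_iff del: lin_rec.simps)
  have all: "K_all n \<kappa> = ?T \<union> E_exc n \<kappa>"
  proof (intro equalityI subsetI)
    fix S :: "'p mod_ring sextuple" assume "S \<in> K_all n \<kappa>"
    with two show "S \<in> ?T \<union> E_exc n \<kappa>"
    proof (cases rule: K_all_cases)
      case (exc \<sigma>)
      then show ?thesis using four by (auto simp: E simp del: of_nat_Suc)
    next
      case zero
      then show ?thesis by (simp add: E)
    qed blast
  next
    fix S :: "'p mod_ring sextuple" assume "S \<in> ?T \<union> E_exc n \<kappa>"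
    then show "S \<in> K_all n \<kappa>"
      by (auto simp: E split: if_splits intro!: zero K_all_Sigma
          intro: exc K_sext_in_K_all[OF two])
  qed
  have disj: "?T \<inter> E_exc n \<kappa> = {}"
  proof (rule ccontr)
    assume "?T \<inter> E_exc n \<kappa> \<noteq> {}"
    then obtain \<alpha> \<beta> :: "'p mod_ring" and \<sigma> where T: "(\<alpha>, \<beta>) \<in> T_all n \<kappa>" and \<sigma>: "\<sigma> \<in> Sigma_group"
      and S: "map_sext \<sigma> (K_sext (\<alpha>, \<beta>)) \<in> E_exc n \<kappa>" by blast
    from T have \<beta>: "\<beta> \<noteq> 0" "A_half n \<beta> = 0" by (auto simp: T_all_def A_half_def)
    from S show False
    proof (cases "of_int \<kappa> = (0 :: 'p mod_ring)")
      case True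
      then show False using S \<sigma> \<beta> by (auto simp: E K_sext_def Let_def sext_def Sigma_group_def)
    next
      case False
      with S obtain \<tau> where N: "?N \<noteq> 0" and \<tau>: "\<tau> \<in> Sigma_group"
        and eq: "map_sext \<sigma> (K_sext (\<alpha>, \<beta>)) = map_sext \<tau> (K_sext (2, 2))"
        by (auto simp: E split: if_splits)
      from \<sigma> obtain d e f where s: "\<And>x y z. \<sigma> (x, y, z) = (d * x, e * y, f * z)"
        "d * e = f" "e * f = d" "f * d = e" "d * d = 1" "e * e = 1" "f * f = 1"
        by (rule Sigma_cases) blast
      from \<tau> obtain d' e' f' where t: "\<And>x y z. \<tau> (x, y, z) = (d' * x, e' * y, f' * z)"
        "d' * e' = f'" "e' * f' = d'" "f' * d' = e'" "d' * d' = 1" "e' * e' = 1" "f' * f' = 1"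
        by (rule Sigma_cases) blast
      have "d * \<beta> = d' * 2" "e * \<beta> = e' * 2" "f * \<beta> = f' * 2"
        using eq by (simp_all add: K_sext_def Let_def s(1) t(1))
      then have "d * (d * \<beta>) = d * (d' * 2)" "e * (e * \<beta>) = e * (e' * 2)" "f * (f * \<beta>) = f * (f' * 2)"
        by simp_all
      then have b: "\<beta> = d * d' * 2" "\<beta> = e * e' * 2" "\<beta> = f * f' * 2"
        by (simp_all only: s(5-7) mult_1 flip: mult.assoc)
      \<comment> \<open>\<beta> is 2 times each of the signs \<open>d * d'\<close>,
        \<open>e * e'\<close>, \<open>f * f'\<close>. The first two agree and the third is their
        product, so it is the square of a sign and \<beta> = 2, where \<open>A_half\<close> takes
        the nonzero value 2n + 1.\<close>
      have "d * d' = e * e'" using b(1,2) two by (metis mult_right_cancel)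
      moreover have "f * f' = (d * d') * (e * e')" by (simp only: mult_ac flip: s(2) t(2))
      moreover have "(d * d') * (d * d') = (d * d) * (d' * d')" by (simp only: mult_ac)
      ultimately have "f * f' = 1" by (simp only: s(5) t(5) mult_1)
      then have "\<beta> = 2" using b(3) by simp
      then show False using \<beta> N A_half_2[OF two, of n] by simp
    qed
  qed
  define D where "D S \<longleftrightarrow> (case S of (X1, X2, X3, Y1, Y2, Y3) \<Rightarrow>
      distinct [X1, X2, X3, Y1, Y2, Y3])" for S :: "'p mod_ring sextuple"
  have "K_dist n \<kappa> = {S \<in> K_all n \<kappa>. D S}"
    unfolding K_dist_def D_def by (intro Collect_cong) (auto split: prod.splits)
  also have "\<dots> = {S \<in> ?T. D S}"
  proof -
    \<comment> \<open>All six triples of an exceptional sextuple coincide.\<close>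
    have "\<not> D S" if "S \<in> E_exc n \<kappa>" for S
      using that distinct_map_sext[of _ "K_sext (2, 2 :: 'p mod_ring)"]
      by (auto simp: E D_def sext_def K_sext_def split: if_splits)
    then show ?thesis unfolding all by blast
  qed
  also have "\<dots> = {map_sext \<sigma> (K_sext (\<alpha>, \<beta>)) | \<alpha> \<beta> \<sigma>. (\<alpha>, \<beta>) \<in> T_dist n \<kappa> \<and> \<sigma> \<in> Sigma_group}"
  proof -
    have "D (map_sext \<sigma> (K_sext (\<alpha>, \<beta>))) \<longleftrightarrow> (\<alpha>, \<beta>) \<in> T_dist n \<kappa>"
      if "(\<alpha>, \<beta>) \<in> T_all n \<kappa>" "\<sigma> \<in> Sigma_group" for \<alpha> \<beta> \<sigma>
      unfolding D_def distinct_map_sext[OF that(2)]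
      using that distinct_K_sext_iff[OF two, of \<kappa> \<beta> \<alpha>] by (simp add: T_dist_def T_all_def)
    moreover have "(\<alpha>, \<beta>) \<in> T_all n \<kappa>" if "(\<alpha>, \<beta>) \<in> T_dist n \<kappa>" for \<alpha> \<beta> :: "'p mod_ring"
      using that by (simp add: T_dist_def)
    ultimately show ?thesis by blast
  qed
  finally show ?thesis using all disj by blast
qed

end
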